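(* There exists an Orlicz function $\widetilde M$ with the property that the corresponding Orlicz sequence space $\ell_{\widetilde M}$ does not factorize through $\ell_2$, that is, $$\ell_{\widetilde M}\odot M(\ell_{\widetilde M},\ell_2)\neq\ell_2,$$ but at the same time $M(\ell_{\widetilde M},\ell_2)\neq\ell_\infty$.
   Context: An Orlicz function is a convex and strictly increasing function $M\colon[0,\infty)\to[0,\infty)$ vanishing at zero. The Orlicz sequence space $\ell_M$ consists of all sequences $x$ with $\sum_nM(|x_n|/\varrho)<\infty$ for some $\varrho>0$, with norm $\inf\{\varrho>0:\sum_nM(|x_n|/\varrho)\le1\}$. For sequence spaces $X,Y$: $M(X,Y)=\{g:fg\in Y\ \forall f\in X\}$ with norm $\sup_{\|f\|_X\le1}\|fg\|_Y$, and $X\odot Y=\{gh:g\in X,h\in Y\}$ with $\|f\|_{X\odot Y}=\inf\{\|g\|_X\|h\|_Y:f=gh\}$. Equality "$=$" of spaces means equality as sets with equivalent (quasi-)norms; "$\ne$" is its negation. *)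

theory Defs
  imports "HOL-Analysis.Analysis"
begin

text \<open>
  A sequence space is a set of real sequences together with its (quasi-)norm.
  Norms are \<open>ennreal\<close>-valued so that the infima and suprema below are never
  those of an empty or unbounded set of reals; a norm is only meaningful on \<open>elems\<close>.
\<close>

record seq_space =
  elems :: "(nat \<Rightarrow> real) set"
  snorm :: "(nat \<Rightarrow> real) \<Rightarrow> ennreal"

text \<open>A function on \<open>[0,\<infinity>)\<close> is a total function whose values at negative arguments are irrelevant.\<close>

definition orlicz_function :: "(real \<Rightarrow> real) \<Rightarrow> bool" where
  "orlicz_function M \<longleftrightarrow>
     M ` {0..} \<subseteq> {0..} \<and> convex_on {0..} M \<and> strict_mono_on {0..} M \<and> M 0 = 0"

definition orlicz_space :: "(real \<Rightarrow> real) \<Rightarrow> seq_space" where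
  "orlicz_space M =
     \<lparr> elems = {x. \<exists>\<rho>>0. summable (\<lambda>n. M (\<bar>x n\<bar> / \<rho>))},
       snorm = (\<lambda>x. Inf {ennreal \<rho> | \<rho>. \<rho> > 0 \<and>
                  summable (\<lambda>n. M (\<bar>x n\<bar> / \<rho>)) \<and> (\<Sum>n. M (\<bar>x n\<bar> / \<rho>)) \<le> 1}) \<rparr>"

definition ell2 :: seq_space where
  "ell2 =
     \<lparr> elems = {x. summable (\<lambda>n. \<bar>x n\<bar>\<^sup>2)},
       snorm = (\<lambda>x. ennreal (sqrt (\<Sum>n. \<bar>x n\<bar>\<^sup>2))) \<rparr>"

definition ell_inf :: seq_space where
  "ell_inf =
     \<lparr> elems = {x. bounded (range x)},
       snorm = (\<lambda>x. SUP n. ennreal \<bar>x n\<bar>) \<rparr>"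

definition multipliers :: "seq_space \<Rightarrow> seq_space \<Rightarrow> seq_space" where
  "multipliers X Y =
     \<lparr> elems = {g. \<forall>f\<in>elems X. (\<lambda>n. f n * g n) \<in> elems Y},
       snorm = (\<lambda>g. SUP f\<in>{f \<in> elems X. snorm X f \<le> 1}. snorm Y (\<lambda>n. f n * g n)) \<rparr>"

definition product_space :: "seq_space \<Rightarrow> seq_space \<Rightarrow> seq_space" (infixl "\<odot>" 70) where
  "X \<odot> Y =
     \<lparr> elems = {(\<lambda>n. g n * h n) | g h. g \<in> elems X \<and> h \<in> elems Y},
       snorm = (\<lambda>f. Inf {snorm X g * snorm Y h | g h.
                  g \<in> elems X \<and> h \<in> elems Y \<and> f = (\<lambda>n. g n * h n)}) \<rparr>"

definition same_space :: "seq_space \<Rightarrow> seq_space \<Rightarrow> bool" (infix "\<simeq>" 50) where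
  "X \<simeq> Y \<longleftrightarrow> elems X = elems Y \<and>
     (\<exists>C>0. \<forall>x\<in>elems X. snorm X x \<le> ennreal C * snorm Y x \<and> snorm Y x \<le> ennreal C * snorm X x)"

end

theory Submission imports Defs begin

text \<open>
  It suffices to find an Orlicz function \<open>M\<close> for which \<open>\<ell>\<^sub>M\<close> and \<open>\<ell>\<^sub>2\<close> are incomparable as sets.
  If \<open>y \<in> \<ell>\<^sub>M - \<ell>\<^sub>2\<close>, then the constant sequence \<open>1\<close> is bounded but does not multiply
  \<open>\<ell>\<^sub>M\<close> into \<open>\<ell>\<^sub>2\<close>.  On the other hand every multiplier from \<open>\<ell>\<^sub>M\<close> to \<open>\<ell>\<^sub>2\<close> is bounded
  (\<open>multipliers_ell2_bounded\<close>) and \<open>\<ell>\<^sub>M\<close> is stable under bounded multiplication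
  (\<open>orlicz_space_mult_bounded\<close>), so \<open>\<ell>\<^sub>M \<odot> M(\<ell>\<^sub>M, \<ell>\<^sub>2) \<subseteq> \<ell>\<^sub>M\<close>, and any
  \<open>x \<in> \<ell>\<^sub>2 - \<ell>\<^sub>M\<close> fails to factorize.

  For incomparability \<open>M\<close> must oscillate around \<open>t\<^sup>2\<close> near \<open>0\<close>.  The function \<open>osc\<close> is
  piecewise linear, with knots tending to \<open>0\<close> so fast that it is far below \<open>t\<^sup>2\<close> at each
  knot, because the slope to the left of it is tiny, while the slope picked up at the knot puts
  it far above \<open>t\<^sup>2\<close> at twice the knot.  Such pointwise gaps turn into sequences by repeating
  the values in question sufficiently often (\<open>repeated_values\<close>).
\<close>

section \<open>Multipliers of Orlicz sequence spaces\<close>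

text \<open>
  If \<open>\<bar>g\<bar> \<ge> 2\<^sup>k\<close> at the \<open>k\<close>-th term of a subsequence, then placing \<open>2\<^sup>-\<^sup>k\<close> there yields a
  sequence that lies in every Orlicz space, by \<open>M (2\<^sup>-\<^sup>k) \<le> 2\<^sup>-\<^sup>k M 1\<close>, and whose product with
  \<open>g\<close> does not tend to \<open>0\<close>.
\<close>

lemma multipliers_ell2_bounded:
  assumes M: "orlicz_function M" and g: "g \<in> elems (multipliers (orlicz_space M) ell2)"
  shows "bounded (range g)"
proof (rule ccontr)
  assume unb: "\<not> bounded (range g)"
  have ex: "\<exists>n>m. B \<le> \<bar>g n\<bar>" for m B
  proof (rule ccontr)
    assume "\<not> (\<exists>n>m. B \<le> \<bar>g n\<bar>)"
    then have "g ` {m<..} \<subseteq> cball 0 B" by force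
    then have "bounded (g ` {..m} \<union> g ` {m<..})"
      by (meson bounded_Un bounded_cball bounded_subset finite_atMost finite_imageI finite_imp_bounded)
    moreover have "g ` {..m} \<union> g ` {m<..} = range g"
      by (auto simp: image_Un[symmetric] ivl_disj_un)
    ultimately show False using unb by simp
  qed
  have "\<exists>r. \<forall>k. (2 ^ k \<le> \<bar>g (r k)\<bar>) \<and> r k < r (Suc k)"
    by (rule dependent_nat_choice) (use ex in blast)+
  then obtain r where r: "\<And>k. 2 ^ k \<le> \<bar>g (r k)\<bar>" and rS: "\<And>k. r k < r (Suc k)" by blast
  have sm: "strict_mono r" using rS by (simp add: strict_mono_Suc_iff)
  then have inj: "inj r" by (rule strict_mono_imp_inj_on)
  define f :: "nat \<Rightarrow> real" where "f n = (if n \<in> range r then (1/2) ^ inv r n else 0)" for n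
  have fr: "f (r k) = (1/2) ^ k" for k using inj by (simp add: f_def)
  have M0: "M 0 = 0" and Mpos: "\<And>t. 0 \<le> t \<Longrightarrow> 0 \<le> M t" and conv: "convex_on {0..} M"
    using M by (auto simp: orlicz_function_def)
  have Mk: "M ((1/2) ^ k) \<le> (1/2) ^ k * M 1" for k
    using convex_onD[OF conv, of "(1/2)^k" 0 1] M0 by (simp add: power_le_one)
  have "summable (\<lambda>k. (1/2) ^ k * M 1)" by (intro summable_mult2 summable_geometric) simp
  then have "summable (\<lambda>k. M ((1/2) ^ k))"
    by (rule summable_comparison_test'[where N = 0]) (use Mk Mpos in auto)
  then have "summable (\<lambda>k. M (\<bar>f (r k)\<bar> / 1))" by (simp add: fr)
  moreover have "summable (\<lambda>k. M (\<bar>f (r k)\<bar> / 1)) = summable (\<lambda>n. M (\<bar>f n\<bar> / 1))"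
    by (rule summable_mono_reindex[OF sm]) (simp add: f_def M0)
  ultimately have "f \<in> elems (orlicz_space M)"
    unfolding orlicz_space_def by (auto intro!: exI[of _ 1])
  with g have "(\<lambda>n. f n * g n) \<in> elems ell2" by (simp add: multipliers_def)
  then have "summable (\<lambda>n. \<bar>f n * g n\<bar>\<^sup>2)" by (simp add: ell2_def)
  then have "summable (\<lambda>k. \<bar>f (r k) * g (r k)\<bar>\<^sup>2)"
    by (subst summable_mono_reindex[OF sm, where f = "\<lambda>n. \<bar>f n * g n\<bar>\<^sup>2"]) (auto simp: f_def)
  then have "(\<lambda>k. \<bar>f (r k) * g (r k)\<bar>\<^sup>2) \<longlonglongrightarrow> 0" by (rule summable_LIMSEQ_zero)
  moreover have "1 \<le> \<bar>f (r k) * g (r k)\<bar>\<^sup>2" for k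
  proof -
    have "1 \<le> \<bar>f (r k) * g (r k)\<bar>"
      using r[of k] by (simp add: fr abs_mult power_one_over field_simps)
    then show ?thesis by (rule one_le_power)
  qed
  ultimately have "(1::real) \<le> 0" by (meson LIMSEQ_le_const)
  then show False by simp
qed

lemma orlicz_space_mult_bounded:
  assumes M: "orlicz_function M" and f: "f \<in> elems (orlicz_space M)" and h: "bounded (range h)"
  shows "(\<lambda>n. f n * h n) \<in> elems (orlicz_space M)"
proof -
  have mono: "strict_mono_on {0..} M" and Mpos: "\<And>t. 0 \<le> t \<Longrightarrow> 0 \<le> M t"
    using M by (auto simp: orlicz_function_def)
  obtain B where B: "B > 0" "\<And>n. \<bar>h n\<bar> \<le> B"
    using h by (auto simp: bounded_pos)
  obtain \<rho> where \<rho>: "\<rho> > 0" "summable (\<lambda>n. M (\<bar>f n\<bar> / \<rho>))"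
    using f by (auto simp: orlicz_space_def)
  have "\<bar>f n * h n\<bar> / (\<rho> * B) \<le> \<bar>f n\<bar> / \<rho>" for n
    using B \<rho> mult_left_mono[OF B(2)[of n], of "\<bar>f n\<bar>"] by (simp add: field_simps abs_mult)
  then have "M (\<bar>f n * h n\<bar> / (\<rho> * B)) \<le> M (\<bar>f n\<bar> / \<rho>)" for n
    using B \<rho> by (intro strict_mono_on_leD[OF mono]) auto
  then have "summable (\<lambda>n. M (\<bar>f n * h n\<bar> / (\<rho> * B)))"
    using B \<rho> Mpos by (intro summable_comparison_test'[OF \<rho>(2), where N = 0]) auto
  then show ?thesis
    using B \<rho> unfolding orlicz_space_def by (auto intro!: exI[of _ "\<rho> * B"])
qed

lemma not_factorizes_ell2_if_not_subset:
  assumes M: "orlicz_function M"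
    and x: "x \<in> elems ell2" "x \<notin> elems (orlicz_space M)"
  shows "\<not> (orlicz_space M \<odot> multipliers (orlicz_space M) ell2 \<simeq> ell2)"
proof
  assume "orlicz_space M \<odot> multipliers (orlicz_space M) ell2 \<simeq> ell2"
  then have "x \<in> elems (orlicz_space M \<odot> multipliers (orlicz_space M) ell2)"
    using x by (simp add: same_space_def)
  then obtain g h where "x = (\<lambda>n. g n * h n)" "g \<in> elems (orlicz_space M)"
    "h \<in> elems (multipliers (orlicz_space M) ell2)"
    by (auto simp: product_space_def)
  then show False
    using x orlicz_space_mult_bounded[OF M] multipliers_ell2_bounded[OF M] by blast
qed

lemma multipliers_not_ell_inf:
  assumes "y \<in> elems X" "y \<notin> elems Y"
  shows "\<not> (multipliers X Y \<simeq> ell_inf)"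
proof
  assume "multipliers X Y \<simeq> ell_inf"
  moreover have "(\<lambda>n. 1) \<in> elems ell_inf" by (auto simp: ell_inf_def)
  ultimately have "(\<lambda>n. 1) \<in> elems (multipliers X Y)" by (simp add: same_space_def)
  then show False using assms by (auto simp: multipliers_def)
qed

section \<open>Sequences with prescribed repetitions\<close>

text \<open>
  The value \<open>t k\<close> is repeated \<open>\<lceil>1 / c k\<rceil>\<close> times.  Its copies then contribute at
  least \<open>1\<close> to the sum of \<open>\<psi>\<close> whenever \<open>\<psi> (t k) \<ge> c k\<close>, but at most
  \<open>2\<^sup>-\<^sup>k + 2\<^sup>-\<^sup>k\<close> to the sum of \<open>\<phi>\<close>, the second summand being the cost of
  rounding up.  The copies are laid out along the pairing of \<open>\<nat> \<times> \<nat>\<close> with \<open>\<nat>\<close>, so that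
  no positions have to be computed.
\<close>

lemma repeated_values:
  fixes \<phi> :: "real \<Rightarrow> real" and t c :: "nat \<Rightarrow> real"
  assumes \<phi>0: "\<phi> 0 = 0" and \<phi>pos: "\<And>k. 0 \<le> \<phi> (t k)"
    and tpos: "\<And>k. 0 \<le> t k" and cpos: "\<And>k. 0 < c k"
    and le1: "\<And>k. \<phi> (t k) \<le> (1/2) ^ k * c k" and le2: "\<And>k. \<phi> (t k) \<le> (1/2) ^ k"
  obtains x :: "nat \<Rightarrow> real" where "\<And>n. 0 \<le> x n" "summable (\<lambda>n. \<phi> (x n))"
    "\<And>\<psi>. (\<And>s. 0 \<le> s \<Longrightarrow> 0 \<le> \<psi> s) \<Longrightarrow> \<forall>\<^sub>F k in sequentially. c k \<le> \<psi> (t k) \<Longrightarrow>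
       \<not> summable (\<lambda>n. \<psi> (x n))"
proof -
  define N where "N k = nat \<lceil>1 / c k\<rceil>" for k
  define z where "z = (\<lambda>(k, i). if i < N k then t k else 0)"
  define x where "x n = z (prod_decode n)" for n
  have zpos: "0 \<le> z p" for p using tpos by (auto simp: z_def split: prod.split)
  have N1: "1 / c k \<le> real (N k)" and N2: "real (N k) \<le> 1 / c k + 1" for k
    using cpos[of k] by (auto simp: N_def of_nat_nat less_imp_le intro: order.trans)
  have N\<phi>: "real (N k) * \<phi> (t k) \<le> 2 * (1/2) ^ k" for k
  proof -
    have "real (N k) * \<phi> (t k) \<le> (1 / c k + 1) * \<phi> (t k)"
      using N2 \<phi>pos by (rule mult_right_mono)
    also have "\<dots> = \<phi> (t k) / c k + \<phi> (t k)" by (simp add: algebra_simps)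
    also have "\<dots> \<le> (1/2) ^ k + (1/2) ^ k"
      using le1[of k] le2[of k] cpos[of k] by (intro add_mono) (auto simp: divide_le_eq)
    finally show ?thesis by simp
  qed
  have reindex: "summable (\<lambda>n. \<theta> (x n)) \<longleftrightarrow> (\<lambda>p. \<theta> (z p)) summable_on UNIV"
    if "\<And>p. 0 \<le> \<theta> (z p)" for \<theta> :: "real \<Rightarrow> real"
  proof -
    have "summable (\<lambda>n. \<theta> (x n)) \<longleftrightarrow> (\<lambda>n. \<theta> (x n)) summable_on UNIV"
      using that by (intro summable_on_UNIV_nonneg_real_iff[symmetric]) (simp add: x_def)
    also have "\<dots> \<longleftrightarrow> (\<lambda>p. \<theta> (z p)) summable_on UNIV"
      unfolding x_def by (rule summable_on_reindex_bij_betw[OF bij_prod_decode, of "\<lambda>p. \<theta> (z p)"])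
    finally show ?thesis .
  qed
  show thesis
  proof (rule that)
    show "0 \<le> x n" for n by (simp add: x_def zpos)
  next
    have \<phi>z: "0 \<le> \<phi> (z p)" for p
      using \<phi>0 \<phi>pos by (auto simp: z_def split: prod.split)
    have row: "((\<lambda>i. \<phi> (z (k, i))) has_sum real (N k) * \<phi> (t k)) UNIV" for k
    proof -
      have "((\<lambda>i. \<phi> (z (k, i))) has_sum (\<Sum>i<N k. \<phi> (z (k, i)))) UNIV"
        by (rule has_sum_finite_neutralI[of "{..<N k}"]) (auto simp: z_def \<phi>0)
      then show ?thesis by (simp add: z_def)
    qed
    have "summable (\<lambda>k. 2 * (1/2::real) ^ k)" by (intro summable_mult summable_geometric) simp
    then have "summable (\<lambda>k. real (N k) * \<phi> (t k))"
      by (rule summable_comparison_test'[where N = 0]) (use N\<phi> \<phi>pos in \<open>auto simp: abs_mult\<close>)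
    then have "(\<lambda>k. real (N k) * \<phi> (t k)) summable_on UNIV"
      using \<phi>pos by (subst summable_on_UNIV_nonneg_real_iff) auto
    then have "(\<lambda>p. \<phi> (z p)) summable_on (SIGMA k:UNIV. UNIV)"
      by (intro summable_on_SigmaI[OF row]) (auto simp: \<phi>z)
    then show "summable (\<lambda>n. \<phi> (x n))" by (simp add: reindex \<phi>z)
  next
    fix \<psi> :: "real \<Rightarrow> real"
    assume \<psi>pos: "\<And>s. 0 \<le> s \<Longrightarrow> 0 \<le> \<psi> s" and big: "\<forall>\<^sub>F k in sequentially. c k \<le> \<psi> (t k)"
    show "\<not> summable (\<lambda>n. \<psi> (x n))"
    proof
      assume "summable (\<lambda>n. \<psi> (x n))"
      then have sz: "(\<lambda>p. \<psi> (z p)) summable_on UNIV" using reindex \<psi>pos zpos by blast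
      obtain K where K: "\<And>k. k \<ge> K \<Longrightarrow> c k \<le> \<psi> (t k)"
        using big by (auto simp: eventually_sequentially)
      have block: "1 \<le> (\<Sum>i<N k. \<psi> (z (k, i)))" if "k \<ge> K" for k
      proof -
        have "1 = 1 / c k * c k" using cpos[of k] by simp
        also have "\<dots> \<le> real (N k) * \<psi> (t k)"
          using N1 K[OF that] cpos[of k] by (intro mult_mono) auto
        also have "\<dots> = (\<Sum>i<N k. \<psi> (z (k, i)))" by (simp add: z_def)
        finally show ?thesis .
      qed
      obtain m :: nat where m: "infsum (\<lambda>p. \<psi> (z p)) UNIV < real m" using reals_Archimedean2 by blast
      have "real m \<le> (\<Sum>k\<in>{K..<K+m}. \<Sum>i<N k. \<psi> (z (k, i)))"
        using sum_bounded_below[of "{K..<K+m}" 1 "\<lambda>k. \<Sum>i<N k. \<psi> (z (k, i))"] block by simp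
      also have "\<dots> = (\<Sum>p\<in>(SIGMA k:{K..<K+m}. {..<N k}). \<psi> (z p))"
        by (simp add: sum.Sigma)
      also have "\<dots> \<le> infsum (\<lambda>p. \<psi> (z p)) UNIV"
        by (rule finite_sum_le_infsum[OF sz]) (auto simp: \<psi>pos zpos)
      finally show False using m by simp
    qed
  qed
qed

section \<open>An Orlicz function oscillating around the square\<close>

definition knot :: "nat \<Rightarrow> real" where
  "knot j = (1/2) ^ (4 * j * (j + 1))"

text \<open>
  The factor \<open>8\<^sup>j\<close> absorbs \<open>(j + 1)\<^sup>2 \<le> 4\<^sup>j\<close>, which pays for dividing arguments by \<open>j + 1\<close>,
  and leaves \<open>2\<^sup>j\<close> as the gap over \<open>t\<^sup>2\<close>.
\<close>

definition slope_jump :: "nat \<Rightarrow> real" where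
  "slope_jump j = 4 * 8 ^ j * knot j"

definition osc :: "real \<Rightarrow> real" where
  "osc t = (\<Sum>j. slope_jump j * max 0 (t - knot j))"

lemma knot_pos: "0 < knot j"
  by (simp add: knot_def)

lemma slope_jump_pos: "0 < slope_jump j"
  by (simp add: slope_jump_def knot_pos)

lemma knot_antimono: "i \<le> j \<Longrightarrow> knot j \<le> knot i"
  unfolding knot_def by (intro power_decreasing mult_le_mono) auto

lemma slope_jump_eq: "slope_jump j = 4 * (1/2) ^ (j * (4 * j + 1))"
proof -
  have "(8::real) ^ j = 2 ^ (3 * j)" by (simp add: power_mult)
  moreover have "4 * j * (j + 1) = 3 * j + j * (4 * j + 1)" by (simp add: algebra_simps)
  then have "knot j = (1/2) ^ (3 * j) * (1/2) ^ (j * (4 * j + 1))"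
    unfolding knot_def by (metis power_add)
  ultimately show ?thesis
    by (simp add: slope_jump_def power_one_over)
qed

text \<open>
  Along the knots, all later jumps together are negligible against the current knot; the factor
  \<open>2\<^sup>-\<^sup>j\<^sup>-\<^sup>1\<close> allows summation over \<open>j\<close>.
\<close>

lemma slope_jump_le:
  assumes "k < j"
  shows "slope_jump j \<le> (1/2) ^ k * knot k * (1/2) ^ Suc j"
proof -
  have "(k + 1) * (k + 1) \<le> j * j" using assms by (intro mult_le_mono) auto
  then have "k + 4 * k * (k + 1) + Suc j + 2 \<le> j * (4 * j + 1)"
    by (simp add: algebra_simps)
  then have "(1/2::real) ^ (j * (4 * j + 1)) \<le> (1/2) ^ (k + 4 * k * (k + 1) + Suc j + 2)"
    by (intro power_decreasing) auto
  then have "slope_jump j \<le> 4 * (1/2::real) ^ (k + 4 * k * (k + 1) + Suc j + 2)"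
    unfolding slope_jump_eq by simp
  also have "\<dots> = (1/2) ^ k * knot k * (1/2) ^ Suc j"
    unfolding knot_def power_add by (simp add: power2_eq_square)
  finally show ?thesis .
qed

lemma summable_slope_jump: "summable slope_jump"
proof -
  have "summable (\<lambda>j. (1/2::real) ^ Suc j)" by (simp add: summable_geometric)
  then show ?thesis
  proof (rule summable_comparison_test'[where N = 1])
    fix j :: nat assume "1 \<le> j"
    then show "norm (slope_jump j) \<le> (1/2) ^ Suc j"
      using slope_jump_le[of 0 j] slope_jump_pos[of j] by (simp add: knot_def)
  qed
qed

lemma summable_osc: "summable (\<lambda>j. slope_jump j * max 0 (t - knot j))"
proof (rule summable_comparison_test'[where N = 0])
  show "summable (\<lambda>j. slope_jump j * \<bar>t\<bar>)" by (intro summable_mult2 summable_slope_jump)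
  fix j show "norm (slope_jump j * max 0 (t - knot j)) \<le> slope_jump j * \<bar>t\<bar>"
    using slope_jump_pos[of j] knot_pos[of j] by (simp add: abs_mult)
qed

lemma osc_ge_term: "slope_jump j * max 0 (t - knot j) \<le> osc t"
  using sum_le_suminf[OF summable_osc, of "{j}" t] slope_jump_pos
  by (simp add: osc_def less_imp_le)

lemma osc_nonneg: "0 \<le> osc t"
  by (rule order.trans[OF _ osc_ge_term[of 0]]) (simp add: slope_jump_pos less_imp_le)

lemma osc_0: "osc 0 = 0"
  by (simp add: osc_def knot_pos less_imp_le max_absorb1)

lemma osc_convex: "convex_on {0..} osc"
proof (rule convex_onI)
  fix u x y :: real assume u: "0 < u" "u < 1" "x \<in> {0..}" "y \<in> {0..}"
  let ?h = "\<lambda>t j. slope_jump j * max 0 (t - knot j)"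
  have "?h ((1 - u) *\<^sub>R x + u *\<^sub>R y) j \<le> (1 - u) * ?h x j + u * ?h y j" for j
  proof -
    have "(1 - u) * x + u * y - knot j = (1 - u) * (x - knot j) + u * (y - knot j)"
      by (simp add: algebra_simps)
    also have "\<dots> \<le> (1 - u) * max 0 (x - knot j) + u * max 0 (y - knot j)"
      using u by (intro add_mono mult_left_mono) auto
    finally have "max 0 ((1 - u) * x + u * y - knot j)
        \<le> (1 - u) * max 0 (x - knot j) + u * max 0 (y - knot j)" (is "?l \<le> ?r")
      using u by simp
    then have "slope_jump j * ?l \<le> slope_jump j * ?r"
      using slope_jump_pos[of j] by simp
    then show ?thesis by (simp add: algebra_simps)
  qed
  then have "osc ((1 - u) *\<^sub>R x + u *\<^sub>R y) \<le> (\<Sum>j. (1 - u) * ?h x j + u * ?h y j)"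
    unfolding osc_def by (intro suminf_le summable_osc summable_add summable_mult)
  also have "\<dots> = (1 - u) * osc x + u * osc y"
    unfolding osc_def by (simp add: suminf_add[symmetric] suminf_mult summable_mult summable_osc)
  finally show "osc ((1 - u) *\<^sub>R x + u *\<^sub>R y) \<le> (1 - u) * osc x + u * osc y" .
qed simp

lemma knot_le: "knot k \<le> (1/2) ^ (8 * k)"
proof -
  have "8 * k \<le> 4 * k * (k + 1)" by (cases k) auto
  then show ?thesis unfolding knot_def by (intro power_decreasing) auto
qed

lemma osc_pos:
  assumes "0 < t" shows "0 < osc t"
proof -
  obtain k where "(1/2) ^ k < t" using real_arch_pow_inv[OF assms, of "1/2"] by auto
  moreover have "knot k \<le> (1/2) ^ k"
    by (rule order.trans[OF knot_le]) (simp add: power_decreasing)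
  ultimately have "0 < slope_jump k * max 0 (t - knot k)" by (simp add: slope_jump_pos)
  also have "\<dots> \<le> osc t" by (rule osc_ge_term)
  finally show ?thesis .
qed

lemma orlicz_function_osc: "orlicz_function osc"
proof -
  have "osc a < osc b" if "0 \<le> a" "a < b" for a b
  proof -
    have "osc a \<le> a / b * osc b"
      using convex_onD[OF osc_convex, of "a / b" 0 b] that osc_0 by (simp add: field_simps)
    also have "\<dots> < 1 * osc b"
      using that osc_pos[of b] by (intro mult_strict_right_mono) auto
    finally show ?thesis by simp
  qed
  then show ?thesis
    by (auto simp: orlicz_function_def osc_nonneg osc_convex osc_0 strict_mono_on_def)
qed

lemma osc_knot_le: "osc (knot k) \<le> (1/2) ^ k * (knot k)\<^sup>2"
proof -
  have "osc (knot k) \<le> (\<Sum>j. ((1/2) ^ k * (knot k)\<^sup>2) * (1/2) ^ Suc j)"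
    unfolding osc_def
  proof (intro suminf_le summable_osc summable_mult)
    fix j
    show "slope_jump j * max 0 (knot k - knot j) \<le> ((1/2) ^ k * (knot k)\<^sup>2) * (1/2) ^ Suc j"
    proof (cases "j \<le> k")
      case True
      then show ?thesis using knot_antimono[of j k] by (simp add: max_absorb1)
    next
      case False
      have "slope_jump j * max 0 (knot k - knot j) \<le> slope_jump j * knot k"
        using slope_jump_pos[of j] knot_pos[of j] knot_pos[of k] by (simp add: less_imp_le)
      also have "\<dots> \<le> ((1/2) ^ k * knot k * (1/2) ^ Suc j) * knot k"
        using False knot_pos[of k] by (intro mult_right_mono slope_jump_le) auto
      finally show ?thesis by (simp add: power2_eq_square mult_ac)
    qed
  qed (simp add: summable_geometric)
  also have "\<dots> = ((1/2) ^ k * (knot k)\<^sup>2) * 1"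
    using power_half_series by (simp only: sums_unique[symmetric] sums_mult)
  finally show ?thesis by simp
qed

lemma osc_twice_knot_ge: "4 * 8 ^ k * (knot k)\<^sup>2 \<le> osc (2 * knot k)"
  using osc_ge_term[of k "2 * knot k"] knot_pos[of k]
  by (simp add: slope_jump_def power2_eq_square mult_ac max_absorb2)

section \<open>Incomparability with the square-summable sequences\<close>

text \<open>
  The repeated values are \<open>2 (k + 1) knot k\<close> rather than \<open>2 knot k\<close>: after division by any
  \<open>\<rho> > 0\<close> they are still at least \<open>2 knot k\<close> for large \<open>k\<close>, so a single sequence defeats all
  scales \<open>\<rho>\<close>.
\<close>

lemma ell2_not_subset_osc:
  obtains x where "x \<in> elems ell2" "x \<notin> elems (orlicz_space osc)"
proof -
  define t c where "t k = 2 * real (k + 1) * knot k" and "c k = osc (2 * knot k)" for k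
  have tpos: "0 \<le> t k" for k by (simp add: t_def knot_pos less_imp_le)
  have cpos: "0 < c k" for k by (simp add: c_def osc_pos knot_pos)
  have sq: "(t k)\<^sup>2 \<le> 4 * 4 ^ k * (knot k)\<^sup>2" for k
  proof -
    have "real (k + 1) \<le> 2 ^ k"
      using less_exp[of k] by (metis Suc_eq_plus1 Suc_leI of_nat_le_iff of_nat_numeral of_nat_power)
    then have "(real (k + 1))\<^sup>2 \<le> (2 ^ k)\<^sup>2" by (intro power_mono) auto
    also have "\<dots> = (4::real) ^ k" by (simp add: power2_eq_square flip: power_mult_distrib)
    finally have "4 * (knot k)\<^sup>2 * (real (k + 1))\<^sup>2 \<le> 4 * (knot k)\<^sup>2 * 4 ^ k"
      by (intro mult_left_mono) auto
    moreover have "(t k)\<^sup>2 = 4 * (knot k)\<^sup>2 * (real (k + 1))\<^sup>2"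
      by (simp only: t_def power_mult_distrib) simp
    ultimately show ?thesis by (simp only: mult_ac)
  qed
  have le1: "(t k)\<^sup>2 \<le> (1/2) ^ k * c k" for k
  proof -
    have "(8::real) ^ k = 4 ^ k * 2 ^ k" by (simp flip: power_mult_distrib)
    then have "4 * 4 ^ k * (knot k)\<^sup>2 = (1/2) ^ k * (4 * 8 ^ k * (knot k)\<^sup>2)"
      by (simp add: power_one_over)
    also have "\<dots> \<le> (1/2) ^ k * c k"
      unfolding c_def by (intro mult_left_mono osc_twice_knot_ge) auto
    finally show ?thesis using sq[of k] by simp
  qed
  have le2: "(t k)\<^sup>2 \<le> 4 * (1/2) ^ k" for k
  proof -
    have "4 ^ k * (knot k)\<^sup>2 \<le> 4 ^ k * ((1/2) ^ (8 * k))\<^sup>2"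
      using knot_le[of k] knot_pos[of k] by (intro mult_left_mono power_mono) auto
    also have "\<dots> = (4 * (1/2) ^ 16) ^ k"
      by (simp add: power_mult_distrib flip: power_mult)
    also have "\<dots> \<le> (1/2) ^ k" by (intro power_mono) (auto simp: power_divide)
    finally show ?thesis using sq[of k] by simp
  qed
  \<comment> \<open>Since \<open>t 0 = 2\<close>, the square violates the bound \<open>\<phi> (t 0) \<le> 1\<close>; hence the division by \<open>4\<close>.\<close>
  obtain x where x: "\<And>n. 0 \<le> x n" "summable (\<lambda>n. (x n)\<^sup>2 / 4)"
    and ns: "\<And>\<psi>. (\<And>s. 0 \<le> s \<Longrightarrow> 0 \<le> \<psi> s) \<Longrightarrow> \<forall>\<^sub>F k in sequentially. c k / 4 \<le> \<psi> (t k) \<Longrightarrow>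
       \<not> summable (\<lambda>n. \<psi> (x n))"
    by (rule repeated_values[of "\<lambda>s. s\<^sup>2 / 4" t "\<lambda>k. c k / 4"])
      (use tpos cpos le1 le2 in \<open>auto simp: field_simps\<close>)
  have "summable (\<lambda>n. 4 * ((x n)\<^sup>2 / 4))" by (intro summable_mult x)
  then have "x \<in> elems ell2" by (simp add: ell2_def)
  moreover have "\<not> summable (\<lambda>n. osc (\<bar>x n\<bar> / \<rho>))" if \<rho>: "\<rho> > 0" for \<rho>
  proof (rule ns[of "\<lambda>s. osc (\<bar>s\<bar> / \<rho>)"])
    obtain K :: nat where K: "\<rho> \<le> real K" using real_arch_simple by blast
    have "c k / 4 \<le> osc (\<bar>t k\<bar> / \<rho>)" if "K \<le> k" for k
    proof -
      have "2 * knot k * \<rho> \<le> 2 * knot k * real (k + 1)"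
        using K that knot_pos[of k] by (intro mult_left_mono) auto
      then have "2 * knot k \<le> \<bar>t k\<bar> / \<rho>"
        using \<rho> tpos[of k] by (simp add: t_def pos_le_divide_eq mult_ac)
      then have "c k \<le> osc (\<bar>t k\<bar> / \<rho>)"
        unfolding c_def using orlicz_function_osc \<rho> knot_pos[of k]
        by (intro strict_mono_on_leD[of "{0..}" osc]) (auto simp: orlicz_function_def)
      then show ?thesis using cpos[of k] by simp
    qed
    then show "\<forall>\<^sub>F k in sequentially. c k / 4 \<le> osc (\<bar>t k\<bar> / \<rho>)"
      by (auto simp: eventually_sequentially)
  qed (simp add: osc_nonneg)
  then have "x \<notin> elems (orlicz_space osc)" by (auto simp: orlicz_space_def)
  ultimately show thesis by (rule that)
qed

lemma osc_not_subset_ell2: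
  obtains y where "y \<in> elems (orlicz_space osc)" "y \<notin> elems ell2"
proof -
  have le2: "osc (knot k) \<le> (1/2) ^ k" for k
  proof -
    have "knot k \<le> 1" by (simp add: knot_def power_le_one)
    then have "(1/2) ^ k * (knot k)\<^sup>2 \<le> (1/2) ^ k * 1"
      using knot_pos[of k] by (intro mult_left_mono power_le_one) auto
    then show ?thesis using osc_knot_le[of k] by linarith
  qed
  obtain y where y: "\<And>n. 0 \<le> y n" "summable (\<lambda>n. osc (y n))"
    and ns: "\<And>\<psi>. (\<And>s. 0 \<le> s \<Longrightarrow> 0 \<le> \<psi> s) \<Longrightarrow> \<forall>\<^sub>F k in sequentially. (knot k)\<^sup>2 \<le> \<psi> (knot k) \<Longrightarrow>
       \<not> summable (\<lambda>n. \<psi> (y n))"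
    by (rule repeated_values[of osc knot "\<lambda>k. (knot k)\<^sup>2"])
      (use osc_0 osc_nonneg knot_pos osc_knot_le le2 in \<open>auto simp: less_imp_le knot_pos[THEN less_imp_neq, THEN not_sym]\<close>)
  have "y \<in> elems (orlicz_space osc)"
    using y unfolding orlicz_space_def by (auto intro!: exI[of _ 1])
  moreover have "y \<notin> elems ell2"
    using ns[of "\<lambda>s. \<bar>s\<bar>\<^sup>2"] by (simp add: ell2_def)
  ultimately show thesis by (rule that)
qed

theorem mainTheorem13:
  "\<exists>M :: real \<Rightarrow> real. orlicz_function M \<and>
     \<not> (orlicz_space M \<odot> multipliers (orlicz_space M) ell2 \<simeq> ell2) \<and>
     \<not> (multipliers (orlicz_space M) ell2 \<simeq> ell_inf)"
proof (intro exI[of _ osc] conjI)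
  show "orlicz_function osc" by (rule orlicz_function_osc)
  show "\<not> (orlicz_space osc \<odot> multipliers (orlicz_space osc) ell2 \<simeq> ell2)"
    using ell2_not_subset_osc not_factorizes_ell2_if_not_subset[OF orlicz_function_osc] by metis
  show "\<not> (multipliers (orlicz_space osc) ell2 \<simeq> ell_inf)"
    using osc_not_subset_ell2 multipliers_not_ell_inf by metis
qed

end
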